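(* Let $n$ be a positive integer, $U_n=\{(\lambda,s,t): |\lambda|=n,\ 1\le s\le D(\lambda),\ 1\le t\le\lambda_1\}$, $Q_n\subseteq U_n$ the set of doubly marked partitions of $n$, and $$W_n=\{(\mu,a,b)\in U_n:\ \mu'_b>s(\mu')\text{ whenever }a=1\}.$$ Then the map $\tau$ defined below is a bijection from $U_n\setminus Q_n$ onto $W_n$.
   Context: Partitions are written with weakly decreasing positive parts $\lambda=(\lambda_1,\dots,\lambda_\ell)$; $\lambda'$ is the conjugate (so $\lambda'_s$ is the number of parts $\ge s$), $D(\lambda)$ is the side length of the Durfee square, and $s(\lambda)$ is the smallest part. A doubly marked partition of $n$ is a triple $(\lambda,s,t)$ with $|\lambda|=n$, $1\le s\le D(\lambda)$, $s\le t\le\lambda_1$, $\lambda'_s=\lambda'_t$. Thus $(\lambda,s,t)\in U_n\setminus Q_n$ means $1\le s\le D(\lambda)$, $1\le t\le\lambda_1$, and either $t<s$ or $\lambda'_s>\lambda'_t$. The map $\tau$ on $U_n\setminus Q_n$: let $p$ be the maximum integer with $\lambda'_p=\lambda'_s$. Define $$\delta=(\lambda_1-p+s-1,\ \dots,\ \lambda_{\lambda'_s}-p+s-1,\ \lambda_{\lambda'_s+1},\ \dots,\ \lambda_\ell)$$ (discarding zero parts, and with $\delta_i=0$ beyond its length). Let $a$ be the minimum integer such that $\delta_a<\lambda'_s$, and let $$\mu=(\delta_1,\dots,\delta_{a-1},\lambda'_s,\lambda'_{s+1},\dots,\lambda'_p,\delta_a,\delta_{a+1},\dots),$$ i.e.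 $\mu$ is obtained from $\delta$ by inserting $p-s+1$ parts equal to $\lambda'_s$. If $t<s$ set $b=t$; if $\lambda'_s>\lambda'_t$ set $b=t-p+s-1$. Then $\tau(\lambda,s,t)=(\mu,a,b)$. *)

theory Defs
  imports Main
begin

definition partition_of :: "nat list \<Rightarrow> nat \<Rightarrow> bool" where
  "partition_of xs n \<longleftrightarrow> sorted_wrt (\<ge>) xs \<and> (\<forall>x\<in>set xs. 0 < x) \<and> sum_list xs = n"

(* 1-based, with value 0 beyond the length (and at the meaningless index 0). *)
definition part :: "nat list \<Rightarrow> nat \<Rightarrow> nat" where
  "part xs i = (if 1 \<le> i \<and> i \<le> length xs then xs ! (i - 1) else 0)"

definition conjugate :: "nat list \<Rightarrow> nat list" where
  "conjugate xs = map (\<lambda>j. length (filter (\<lambda>x. j \<le> x) xs)) [1..<part xs 1 + 1]"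

definition durfee :: "nat list \<Rightarrow> nat" where
  "durfee xs = Max {d. d \<le> length xs \<and> (\<forall>i\<in>{1..d}. d \<le> part xs i)}"

(* Used for nonempty lists only. *)
definition smallest_part :: "nat list \<Rightarrow> nat" where
  "smallest_part xs = Min (set xs)"

definition U :: "nat \<Rightarrow> (nat list \<times> nat \<times> nat) set" where
  "U n = {(xs, s, t). partition_of xs n \<and> 1 \<le> s \<and> s \<le> durfee xs \<and> 1 \<le> t \<and> t \<le> part xs 1}"

definition Q :: "nat \<Rightarrow> (nat list \<times> nat \<times> nat) set" where
  "Q n = {(xs, s, t). partition_of xs n \<and> 1 \<le> s \<and> s \<le> durfee xs \<and> s \<le> t \<and> t \<le> part xs 1
            \<and> part (conjugate xs) s = part (conjugate xs) t}"

definition W :: "nat \<Rightarrow> (nat list \<times> nat \<times> nat) set" where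
  "W n = {(ys, a, b). (ys, a, b) \<in> U n
            \<and> (a = 1 \<longrightarrow> smallest_part (conjugate ys) < part (conjugate ys) b)}"

definition tau_p :: "nat list \<Rightarrow> nat \<Rightarrow> nat" where
  "tau_p xs s = Max {q. part (conjugate xs) q = part (conjugate xs) s}"

(* Each lambda_i - p + s - 1 is written lambda_i + s - (p + 1): since lambda_i \<ge> p for
   i \<le> lambda'_s and s \<ge> 1, the natural-number subtraction never truncates. *)
definition tau_delta :: "nat list \<Rightarrow> nat \<Rightarrow> nat list" where
  "tau_delta xs s = (let m = part (conjugate xs) s; p = tau_p xs s in
     filter (\<lambda>x. 0 < x) (map (\<lambda>x. x + s - (p + 1)) (take m xs) @ drop m xs))"

definition tau_a :: "nat list \<Rightarrow> nat \<Rightarrow> nat" where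
  "tau_a xs s = (LEAST a. 1 \<le> a \<and> part (tau_delta xs s) a < part (conjugate xs) s)"

definition tau_mu :: "nat list \<Rightarrow> nat \<Rightarrow> nat list" where
  "tau_mu xs s = (let d = tau_delta xs s; a = tau_a xs s in
     take (a - 1) d @ map (part (conjugate xs)) [s..<tau_p xs s + 1] @ drop (a - 1) d)"

(* On U n - Q n the case t \<ge> s is exactly the case lambda'_s > lambda'_t; there t > p, so
   t - p + s - 1 does not truncate either. *)
definition tau_b :: "nat list \<Rightarrow> nat \<Rightarrow> nat \<Rightarrow> nat" where
  "tau_b xs s t = (if t < s then t else t + s - (tau_p xs s + 1))"

fun tau :: "nat list \<times> nat \<times> nat \<Rightarrow> nat list \<times> nat \<times> nat" where
  "tau (xs, s, t) = (tau_mu xs s, tau_a xs s, tau_b xs s t)"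

end

(* Both sides are parametrised by a partition d, a rectangle with m rows and w >= 1 columns
   such that d_m < m, and a mark 1 <= b <= d_1.  Adding the rectangle to d as w columns of
   height m gives an element of U_n - Q_n with s = d_m + 1, marked at t = b or b + w; inserting
   it as w parts equal to m gives an element of W_n, with a the first index such that d_a < m.
   In both cases the Durfee condition becomes d_m < m, and for a = 1 the bound b <= d_1 is the
   extra condition defining W_n.  The map tau turns the first description into the second. *)

theory Submission
  imports Defs
begin

section \<open>Indexed access to the parts of a list\<close>

lemma part_Cons: "part (x # xs) i = (if i = 1 then x else part xs (i - 1))"
  by (cases i) (auto simp: part_def nth_Cons')

lemma part_append: "part (xs @ ys) i = (if i \<le> length xs then part xs i else part ys (i - length xs))"
  by (auto simp: part_def nth_append)

lemma part_take: "i \<le> m \<Longrightarrow> part (take m xs) i = part xs i"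
  by (auto simp: part_def)

lemma part_drop: "1 \<le> i \<Longrightarrow> part (drop m xs) i = part xs (m + i)"
  by (auto simp: part_def)

lemma part_replicate: "part (replicate w m) i = (if 1 \<le> i \<and> i \<le> w then m else 0)"
  by (auto simp: part_def)

lemma part_pos_iff: "\<forall>x\<in>set xs. 0 < x \<Longrightarrow> 0 < part xs i \<longleftrightarrow> 1 \<le> i \<and> i \<le> length xs"
  by (auto simp: part_def)

text \<open>With positive entries, the length is the last index at which \<open>part\<close> is
  nonzero, so agreement at all positive indices already forces equal lengths.\<close>

lemma part_eqI:
  assumes "\<forall>x\<in>set xs. 0 < x" "\<forall>x\<in>set ys. 0 < x" "\<And>i. 1 \<le> i \<Longrightarrow> part xs i = part ys i"
  shows "xs = ys"
proof (rule nth_equalityI)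
  have *: "i \<le> length xs \<longleftrightarrow> i \<le> length ys" for i
    using part_pos_iff[OF assms(1), of i] part_pos_iff[OF assms(2), of i] assms(3)[of i]
    by (cases "i = 0") auto
  show len: "length xs = length ys"
    using *[of "length xs"] *[of "length ys"] by simp
  show "xs ! i = ys ! i" if "i < length xs" for i
    using assms(3)[of "Suc i"] that len by (simp add: part_def)
qed

lemma part_antimono:
  assumes "sorted_wrt (\<ge>) xs" "1 \<le> i" "i \<le> j"
  shows "part xs j \<le> part xs i"
proof (cases "i = j")
  case False
  then show ?thesis
    using assms sorted_wrt_nth_less[OF assms(1), of "i - 1" "j - 1"] by (auto simp: part_def)
qed simp

text \<open>In a weakly decreasing list the zeros form a tail, where \<open>part\<close> takes its
  default value 0 anyway once they are discarded.\<close>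

lemma part_filter_pos:
  "sorted_wrt (\<ge>) xs \<Longrightarrow> part (filter (\<lambda>x. 0 < x) xs) i = part xs i" for xs :: "nat list"
proof (induction xs arbitrary: i)
  case (Cons x xs)
  show ?case
  proof (cases "x = 0")
    case True
    then have "\<forall>y\<in>set (x # xs). y = 0" using Cons.prems by auto
    then have "part (x # xs) i = 0" by (auto simp: part_def simp del: set_simps)
    moreover have "filter (\<lambda>x. 0 < x) (x # xs) = []"
      using \<open>\<forall>y\<in>set (x # xs). y = 0\<close> by (auto simp: filter_empty_conv)
    ultimately show ?thesis by (simp only: part_def) simp
  qed (use Cons in \<open>auto simp: part_Cons\<close>)
qed simp

section \<open>Column heights, the conjugate and the Durfee square\<close>

definition height :: "nat list \<Rightarrow> nat \<Rightarrow> nat" where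
  "height xs j = length (filter (\<lambda>x. j \<le> x) xs)"

text \<open>Both sides say that the cell in row \<open>i\<close> and column \<open>j\<close> lies in
  the Young diagram. Later arguments pass between rows and columns through this equivalence.\<close>

lemma le_height_iff:
  assumes "sorted_wrt (\<ge>) xs" "1 \<le> i" "1 \<le> j"
  shows "i \<le> height xs j \<longleftrightarrow> j \<le> part xs i"
  using assms
proof (induction xs arbitrary: i)
  case Nil
  then show ?case by (simp add: height_def part_def)
next
  case (Cons x xs)
  show ?case
  proof (cases "j \<le> x")
    case True
    then show ?thesis
      using Cons.IH[of "i - 1"] Cons.prems
      by (cases "i = 1"; cases "1 \<le> i - 1") (auto simp: height_def part_Cons)
  next
    case False
    then have "filter (\<lambda>x. j \<le> x) (x # xs) = []"
      using Cons.prems by (auto simp: filter_empty_conv)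
    then show ?thesis
      using part_antimono[OF Cons.prems(1), of 1 i] Cons.prems False
      by (auto simp: height_def part_Cons split: if_splits)
  qed
qed

text \<open>The guard \<open>1 \<le> m\<close> lets the rule cover empty columns: index 0 has the
  default value 0, so \<open>j \<le> part xs 0\<close> would fail.\<close>

lemma height_eqI:
  assumes "sorted_wrt (\<ge>) xs" "1 \<le> j" "1 \<le> m \<Longrightarrow> j \<le> part xs m" "part xs (Suc m) < j"
  shows "height xs j = m"
  using le_height_iff[OF assms(1), of m j] le_height_iff[OF assms(1), of "Suc m" j] assms
  by (cases m) auto

lemma height_antimono: "i \<le> j \<Longrightarrow> height xs j \<le> height xs i"
  by (induction xs) (auto simp: height_def)

text \<open>Beyond the first part of \<open>xs\<close> both sides are 0, so \<open>height\<close>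
  can replace the conjugate at every positive index without an upper bound.\<close>

lemma part_conjugate:
  assumes "sorted_wrt (\<ge>) xs" "1 \<le> j"
  shows "part (conjugate xs) j = height xs j"
proof (cases "j \<le> part xs 1")
  case True
  then show ?thesis using assms(2)
    unfolding part_def[of "conjugate xs"]
    by (cases j) (simp_all add: conjugate_def height_def del: upt_Suc)
next
  case False
  then have "height xs j = 0" using le_height_iff[OF assms(1), of 1 j] assms by simp
  then show ?thesis using False
    unfolding part_def[of "conjugate xs"] by (simp add: conjugate_def del: upt_Suc)
qed

lemma part_conjugate_0 [simp]: "part (conjugate xs) 0 = 0"
  by (simp add: part_def)

text \<open>Rows weakly decrease, so a square of side \<open>s\<close> fits as soon as its lowest
  row does.\<close>

lemma le_durfee_iff:
  assumes "sorted_wrt (\<ge>) xs" "1 \<le> s"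
  shows "s \<le> durfee xs \<longleftrightarrow> s \<le> part xs s"
proof -
  let ?A = "{d. d \<le> length xs \<and> (\<forall>i\<in>{1..d}. d \<le> part xs i)}"
  have fin: "finite ?A" by (rule finite_subset[of _ "{..length xs}"]) auto
  have "0 \<in> ?A" by simp
  then have "s \<le> durfee xs \<longleftrightarrow> (\<exists>d\<in>?A. s \<le> d)"
    unfolding durfee_def using Max_ge_iff[OF fin] by blast
  also have "\<dots> \<longleftrightarrow> s \<le> part xs s"
  proof
    assume "\<exists>d\<in>?A. s \<le> d"
    then obtain d where "d \<in> ?A" "s \<le> d" by blast
    then have "d \<le> part xs s" using assms(2) by simp
    then show "s \<le> part xs s" using \<open>s \<le> d\<close> by simp
  next
    assume *: "s \<le> part xs s"
    then have "s \<le> length xs" using assms(2) by (auto simp: part_def split: if_splits)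
    moreover have "\<forall>i\<in>{1..s}. s \<le> part xs i"
      using part_antimono[OF assms(1)] * by (meson atLeastAtMost_iff le_trans)
    ultimately show "\<exists>d\<in>?A. s \<le> d" by blast
  qed
  finally show ?thesis .
qed

text \<open>Column heights weakly decrease, so the last column is a shortest one.\<close>

lemma smallest_part_conjugate:
  assumes "sorted_wrt (\<ge>) xs" "1 \<le> part xs 1"
  shows "smallest_part (conjugate xs) = height xs (part xs 1)"
proof -
  have "set (conjugate xs) = height xs ` {1..part xs 1}"
    by (auto simp: conjugate_def height_def)
  then show ?thesis
    unfolding smallest_part_def using assms(2) by (auto intro!: Min_eqI height_antimono)
qed

text \<open>A column has height at least \<open>m\<close> exactly when it meets row
  \<open>m\<close>, so the last column of height \<open>m\<close> stands at the end of that
  row.\<close>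

lemma tau_p_eq:
  assumes "sorted_wrt (\<ge>) xs" "1 \<le> s" "m = height xs s" "1 \<le> m"
  shows "tau_p xs s = part xs m"
proof -
  have sp: "s \<le> part xs m" using le_height_iff[of xs m s] assms by simp
  have "height xs (part xs m) \<le> m"
    using height_antimono[OF sp] assms(3) by simp
  moreover have "m \<le> height xs (part xs m)"
    using le_height_iff[of xs m "part xs m"] assms sp by simp
  ultimately have eq: "part (conjugate xs) (part xs m) = part (conjugate xs) s"
    using part_conjugate[OF assms(1)] assms sp by simp
  \<comment> \<open>The same bound yields the finiteness that \<open>Max\<close> requires.\<close>
  have bd: "q \<le> part xs m" if "part (conjugate xs) q = part (conjugate xs) s" for q
  proof (cases "q = 0")
    case False
    then have "height xs q = m" using that part_conjugate[OF assms(1)] assms by simp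
    then show ?thesis using le_height_iff[of xs m q] assms False by simp
  qed simp
  show ?thesis
    unfolding tau_p_def
  proof (rule Max_eqI)
    show "finite {q. part (conjugate xs) q = part (conjugate xs) s}"
      by (rule finite_subset[of _ "{..part xs m}"]) (use bd in blast)+
    show "q \<le> part xs m" if "q \<in> {q. part (conjugate xs) q = part (conjugate xs) s}" for q
      using bd that by blast
    show "part xs m \<in> {q. part (conjugate xs) q = part (conjugate xs) s}"
      using eq by blast
  qed
qed

section \<open>Two ways of attaching a rectangle to a partition\<close>

definition add_columns :: "nat list \<Rightarrow> nat \<Rightarrow> nat \<Rightarrow> nat list" where
  "add_columns d m w = map (\<lambda>x. x + w) (take m d @ replicate (m - length d) 0) @ drop m d"

definition insert_parts :: "nat list \<Rightarrow> nat \<Rightarrow> nat \<Rightarrow> nat list" where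
  "insert_parts d m w = take (height d m) d @ replicate w m @ drop (height d m) d"

definition rect_data :: "nat \<Rightarrow> (nat list \<times> nat \<times> nat \<times> nat) set" where
  "rect_data n = {(d, m, w, b). sorted_wrt (\<ge>) d \<and> (\<forall>x\<in>set d. 0 < x) \<and> sum_list d + m * w = n \<and> 0 < w
            \<and> part d m < m \<and> 1 \<le> b \<and> b \<le> part d 1}"

text \<open>The new columns occupy positions \<open>part d m + 1\<close> to
  \<open>part d m + w\<close>. A mark to their left stays, a mark to their right moves by
  \<open>w\<close>, so no mark ever falls on a new column.\<close>

fun column_mark :: "nat list \<times> nat \<times> nat \<times> nat \<Rightarrow> nat list \<times> nat \<times> nat" where
  "column_mark (d, m, w, b) =
     (add_columns d m w, Suc (part d m), if b \<le> part d m then b else b + w)"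

fun row_mark :: "nat list \<times> nat \<times> nat \<times> nat \<Rightarrow> nat list \<times> nat \<times> nat" where
  "row_mark (d, m, w, b) = (insert_parts d m w, Suc (height d m), b)"

text \<open>The zero padding in \<open>add_columns\<close> turns missing rows up to \<open>m\<close>
  into actual entries, so no case distinction on the length of \<open>d\<close> remains.\<close>

lemma part_add_columns:
  "1 \<le> i \<Longrightarrow> part (add_columns d m w) i = (if i \<le> m then part d i + w else part d i)"
  by (auto simp: add_columns_def part_def nth_append min_def)

lemma sum_add_columns: "sum_list (add_columns d m w) = sum_list d + m * w"
proof -
  have "sum_list (add_columns d m w) = sum_list (take m d @ drop m d) + m * w"
    unfolding add_columns_def
    by (cases "m \<le> length d")
      (simp_all add: sum_list_addf sum_list_triv sum_list_replicate algebra_simps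
        del: append_take_drop_id flip: add_mult_distrib)
  then show ?thesis by simp
qed

text \<open>The default value 0 continues a weakly decreasing list of naturals, so the order can be
  tested at all positive indices.\<close>

lemma sorted_wrt_ge_iff_part:
  "sorted_wrt (\<ge>) xs \<longleftrightarrow> (\<forall>i j. 1 \<le> i \<and> i \<le> j \<longrightarrow> part xs j \<le> part xs i)"
proof
  assume *: "\<forall>i j. 1 \<le> i \<and> i \<le> j \<longrightarrow> part xs j \<le> part xs i"
  show "sorted_wrt (\<ge>) xs"
    unfolding sorted_wrt_iff_nth_less
  proof (intro allI impI)
    fix i j assume "i < j" "j < length xs"
    then show "xs ! j \<le> xs ! i"
      using *[rule_format, of "Suc i" "Suc j"] by (simp add: part_def)
  qed
qed (auto intro: part_antimono)

lemma sorted_add_columns: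
  assumes "sorted_wrt (\<ge>) d"
  shows "sorted_wrt (\<ge>) (add_columns d m w)"
  unfolding sorted_wrt_ge_iff_part
proof (intro allI impI)
  fix i j :: nat assume "1 \<le> i \<and> i \<le> j"
  then show "part (add_columns d m w) j \<le> part (add_columns d m w) i"
    using part_antimono[OF assms, of i j] by (auto simp: part_add_columns)
qed

lemma pos_add_columns:
  "\<forall>x\<in>set d. 0 < x \<Longrightarrow> 0 < w \<Longrightarrow> \<forall>x\<in>set (add_columns d m w). 0 < x"
  by (auto simp: add_columns_def dest: in_set_dropD)

text \<open>Row \<open>m\<close> now reaches the first new column, while row \<open>m + 1\<close>
  still has at most \<open>part d m\<close> cells.\<close>

lemma height_add_columns:
  assumes "sorted_wrt (\<ge>) d" "1 \<le> m" "0 < w"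
  shows "height (add_columns d m w) (Suc (part d m)) = m"
  using part_antimono[OF assms(1), of m "Suc m"] assms
  by (intro height_eqI sorted_add_columns) (auto simp: part_add_columns)

lemma height_le_length: "height d m \<le> length d"
  by (simp add: height_def)

lemma ge_take_height:
  assumes "sorted_wrt (\<ge>) d" "1 \<le> m" "x \<in> set (take (height d m) d)"
  shows "m \<le> x"
proof -
  from assms(3) obtain i where "i < height d m" "x = d ! i" "i < length d"
    by (auto simp: in_set_conv_nth)
  then show ?thesis using le_height_iff[OF assms(1), of "Suc i" m] assms(2) by (simp add: part_def)
qed

lemma less_drop_height:
  assumes "sorted_wrt (\<ge>) d" "1 \<le> m" "x \<in> set (drop (height d m) d)"
  shows "x < m"
proof -
  from assms(3) obtain i where "i < length (drop (height d m) d)" "x = drop (height d m) d ! i"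
    by (metis in_set_conv_nth)
  then have "height d m + i < length d" "x = d ! (height d m + i)" by auto
  then show ?thesis
    using le_height_iff[OF assms(1), of "Suc (height d m + i)" m] assms(2) by (simp add: part_def)
qed

lemma sum_insert_parts: "sum_list (insert_parts d m w) = sum_list d + m * w"
proof -
  have "sum_list (insert_parts d m w) = sum_list (take (height d m) d @ drop (height d m) d) + m * w"
    unfolding insert_parts_def by (simp add: sum_list_replicate del: append_take_drop_id)
  then show ?thesis by simp
qed

lemma sorted_insert_parts:
  assumes "sorted_wrt (\<ge>) d" "1 \<le> m"
  shows "sorted_wrt (\<ge>) (insert_parts d m w)"
proof -
  have "sorted_wrt (\<ge>) (replicate w m)" by (induction w) auto
  moreover have ge: "m \<le> x" if "x \<in> set (take (height d m) d)" for x
    using ge_take_height assms that by blast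
  moreover have less: "x < m" if "x \<in> set (drop (height d m) d)" for x
    using less_drop_height assms that by blast
  moreover have "y \<le> x" if "x \<in> set (take (height d m) d)" "y \<in> set (drop (height d m) d)" for x y
    using ge[OF that(1)] less[OF that(2)] by simp
  ultimately show ?thesis
    using assms(1) unfolding insert_parts_def by (auto simp: sorted_wrt_append less_imp_le)
qed

lemma pos_insert_parts:
  "\<forall>x\<in>set d. 0 < x \<Longrightarrow> 1 \<le> m \<Longrightarrow> \<forall>x\<in>set (insert_parts d m w). 0 < x"
  by (auto simp: insert_parts_def dest: in_set_dropD in_set_takeD)

lemma part_insert_parts:
  "1 \<le> i \<Longrightarrow> part (insert_parts d m w) i =
     (if i \<le> height d m then part d i else if i \<le> height d m + w then m else part d (i - w))"
  using height_le_length[of d m]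
  by (auto simp: insert_parts_def part_append part_take part_drop part_replicate)

lemma height_less_if_part_less:
  assumes "sorted_wrt (\<ge>) d" "part d m < m"
  shows "height d m < m"
  using le_height_iff[OF assms(1), of m m] assms(2) by (cases m) auto

section \<open>Rectangles of columns and the set U_n - Q_n\<close>

lemma column_mark_in:
  assumes "x \<in> rect_data n"
  shows "column_mark x \<in> U n - Q n"
proof -
  obtain d m w b where x: "x = (d, m, w, b)" by (cases x)
  let ?l = "add_columns d m w" and ?s = "Suc (part d m)"
  let ?t = "if b \<le> part d m then b else b + w"
  from assms x have d: "sorted_wrt (\<ge>) d" "\<forall>x\<in>set d. 0 < x" "sum_list d + m * w = n" "0 < w"
    "part d m < m" "1 \<le> b" "b \<le> part d 1" by (auto simp: rect_data_def)
  then have m: "1 \<le> m" by simp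
  note so = sorted_add_columns[OF d(1), of m w]
  have P: "partition_of ?l n"
    using so pos_add_columns[OF d(2,4)] sum_add_columns d(3) by (auto simp: partition_of_def)
  \<comment> \<open>Since \<open>?s \<le> m\<close>, row \<open>?s\<close> is one of the lengthened
    rows and has at least \<open>part d m + w\<close> cells.\<close>
  have "part d m \<le> part d ?s" using part_antimono[OF d(1), of ?s m] d(5) by simp
  then have s: "?s \<le> durfee ?l"
    using le_durfee_iff[OF so, of ?s] d(4,5) by (simp add: part_add_columns)
  have t: "1 \<le> ?t" "?t \<le> part ?l 1" using d m by (auto simp: part_add_columns)
  have "part (conjugate ?l) ?s \<noteq> part (conjugate ?l) ?t" if "?s \<le> ?t"
  proof -
    \<comment> \<open>Here \<open>?t\<close> must be \<open>b + w\<close> with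
      \<open>b > part d m\<close>, so column \<open>?t\<close> lies beyond the end of row
      \<open>m\<close> and is shorter than column \<open>?s\<close>.\<close>
    have "part ?l m < ?t" using that m by (auto simp: part_add_columns split: if_splits)
    then have "\<not> m \<le> height ?l ?t" using le_height_iff[OF so m t(1)] by simp
    then have "height ?l ?t \<noteq> height ?l ?s" using height_add_columns[OF d(1) m d(4)] by simp
    then show ?thesis using part_conjugate[OF so] t(1) by simp
  qed
  then show ?thesis using P s t unfolding x by (simp add: U_def Q_def)
qed

text \<open>The preimage arises by deleting columns \<open>s\<close> to \<open>p\<close>, all of
  height \<open>m\<close>. Columns of height \<open>m\<close> to the left of \<open>s\<close> stay
  in \<open>d\<close>.\<close>

lemma in_image_column_mark:
  assumes "y \<in> U n - Q n"
  shows "y \<in> column_mark ` rect_data n"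
proof -
  obtain l s t where y: "y = (l, s, t)" by (cases y)
  from assms y have l: "sorted_wrt (\<ge>) l" "\<forall>x\<in>set l. 0 < x" "sum_list l = n" and s: "1 \<le> s"
    "s \<le> durfee l" and t: "1 \<le> t" "t \<le> part l 1" and nQ: "s \<le> t \<Longrightarrow> height l s \<noteq> height l t"
    by (auto simp: U_def Q_def partition_of_def part_conjugate)
  define m where "m = height l s"
  define p where "p = part l m"
  define w where "w = p + 1 - s"
  define d where "d = filter (\<lambda>x. 0 < x) (map (\<lambda>x. x - w) (take m l) @ drop m l)"
  \<comment> \<open>The Durfee condition, read in column \<open>s\<close>. It becomes
    \<open>part d m < m\<close> because \<open>part d m = s - 1\<close>.\<close>
  have sm: "s \<le> m" using le_durfee_iff[OF l(1) s(1)] s le_height_iff[OF l(1), of s s]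
    by (simp add: m_def)
  have m: "1 \<le> m" using sm s by simp
  have sp: "s \<le> p" using le_height_iff[OF l(1) m s(1)] by (simp add: m_def p_def)
  have lm: "m \<le> length l" by (simp add: m_def height_le_length)
  have p1: "part l (Suc m) < s" using le_height_iff[OF l(1), of "Suc m" s] s by (simp add: m_def)
  have pge: "p \<le> part l i" if "1 \<le> i" "i \<le> m" for i
    using part_antimono[OF l(1)] that by (simp add: p_def)
  let ?e = "map (\<lambda>x. x - w) (take m l) @ drop m l"
  have e: "part ?e i = (if i \<le> m then part l i - w else part l i)" if "1 \<le> i" for i
    using that lm by (auto simp: part_def nth_append)
  have anti: "part l j \<le> part l i" if "1 \<le> i" "i \<le> j" for i j
    using part_antimono[OF l(1)] that by simp
  \<comment> \<open>Only a comparison across row \<open>m\<close> is delicate: an upper row keeps at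
    least \<open>p - w = s - 1\<close> cells, and a lower row has fewer than
    \<open>s\<close>.\<close>
  have se: "sorted_wrt (\<ge>) ?e"
    unfolding sorted_wrt_ge_iff_part
  proof (intro allI impI)
    fix i j :: nat assume ij: "1 \<le> i \<and> i \<le> j"
    show "part ?e j \<le> part ?e i"
    proof (cases "i \<le> m \<and> m < j")
      case True
      then have "part l j \<le> part l (Suc m)" "p \<le> part l i" using anti pge ij by auto
      then show ?thesis using True e ij p1 sp by (simp add: w_def)
    next
      case False
      then show ?thesis using anti[of i j] e ij by (auto simp: diff_le_mono)
    qed
  qed
  have d: "part d i = (if i \<le> m then part l i - w else part l i)" if "1 \<le> i" for i
    using part_filter_pos[OF se] e[OF that] by (simp add: d_def)
  have sd: "sorted_wrt (\<ge>) d" unfolding d_def by (rule sorted_wrt_filter[OF se])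
  have pd: "\<forall>x\<in>set d. 0 < x" by (auto simp: d_def)
  have w: "0 < w" using sp by (simp add: w_def)
  have leq: "l = add_columns d m w"
  proof (rule part_eqI[OF l(2) pos_add_columns[OF pd w]])
    fix i :: nat assume i: "1 \<le> i"
    show "part l i = part (add_columns d m w) i"
      using pge[OF i] i sp s(1) by (auto simp: part_add_columns d w_def)
  qed
  have dm: "Suc (part d m) = s" using d[OF m] sp s(1) by (simp add: w_def p_def)
  \<comment> \<open>A mark from \<open>s\<close> to \<open>p\<close> would sit on a column of height
    \<open>m\<close>, which places the triple in \<open>Q n\<close>.\<close>
  have t': "t < s \<or> p < t"
  proof (rule ccontr)
    assume "\<not> (t < s \<or> p < t)"
    then have "s \<le> t" "t \<le> p" by auto
    then show False
      using nQ height_antimono[of s t l] le_height_iff[OF l(1) m t(1)] by (simp add: m_def p_def)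
  qed
  define b where "b = (if t < s then t else t - w)"
  have b: "1 \<le> b" "b \<le> part d 1" "t = (if b \<le> part d m then b else b + w)"
    using t' t dm pge[of 1] m d[of 1] sp s(1) by (auto simp: b_def w_def)
  have "(d, m, w, b) \<in> rect_data n"
    using sd pd w b sm dm l(3) sum_add_columns[of d m w] leq by (auto simp: rect_data_def)
  moreover have "y = column_mark (d, m, w, b)"
    using y leq dm b(3) by simp
  ultimately show ?thesis by blast
qed

section \<open>Rectangles of rows and the set W_n\<close>

lemma row_mark_in:
  assumes "x \<in> rect_data n"
  shows "row_mark x \<in> W n"
proof -
  obtain d m w b where x: "x = (d, m, w, b)" by (cases x)
  let ?k = "height d m" and ?u = "insert_parts d m w"
  from assms x have d: "sorted_wrt (\<ge>) d" "\<forall>x\<in>set d. 0 < x" "sum_list d + m * w = n" "0 < w"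
    "part d m < m" "1 \<le> b" "b \<le> part d 1" by (auto simp: rect_data_def)
  then have m: "1 \<le> m" by simp
  note so = sorted_insert_parts[OF d(1) m, of w]
  have P: "partition_of ?u n"
    using so pos_insert_parts[OF d(2) m] sum_insert_parts d(3) by (auto simp: partition_of_def)
  have km: "?k < m" by (rule height_less_if_part_less[OF d(1,5)])
  \<comment> \<open>Row \<open>Suc ?k\<close> is the first inserted row, and its length
    \<open>m\<close> exceeds \<open>?k\<close>.\<close>
  have s: "Suc ?k \<le> durfee ?u"
    using le_durfee_iff[OF so, of "Suc ?k"] km d(4) by (simp add: part_insert_parts)
  have k0: "part d 1 < m" if "?k = 0"
    using le_height_iff[OF d(1), of 1 m] m that by simp
  have t: "b \<le> part ?u 1" using d(4,7) k0 by (auto simp: part_insert_parts)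
  \<comment> \<open>For \<open>?k = 0\<close> the inserted rows come first, so the last column has
    height \<open>w\<close>. Row \<open>w + 1\<close> is the first row of \<open>d\<close>, and
    \<open>b \<le> part d 1\<close> makes column \<open>b\<close> reach it.\<close>
  have "smallest_part (conjugate ?u) < part (conjugate ?u) b" if "?k = 0"
  proof -
    have u1: "part ?u 1 = m" using that d(4) by (simp add: part_insert_parts)
    have uw: "part ?u (Suc w) = part d 1" using that by (simp add: part_insert_parts)
    have "part ?u w = m" using that d(4) by (simp add: part_insert_parts)
    then have "height ?u m = w" using so m uw k0 that by (intro height_eqI) auto
    then have "smallest_part (conjugate ?u) = w" using smallest_part_conjugate[OF so] u1 m by simp
    moreover have "Suc w \<le> height ?u b" using le_height_iff[OF so _ d(6), of "Suc w"] uw d(7) by simp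
    ultimately show ?thesis using part_conjugate[OF so d(6)] by simp
  qed
  then show ?thesis using P s t d(6) unfolding x by (simp add: U_def W_def)
qed

text \<open>The preimage arises by deleting rows \<open>a\<close> to \<open>h\<close>, the parts
  equal to \<open>m\<close> from position \<open>a\<close> on. Equal parts above row
  \<open>a\<close> stay in \<open>d\<close>, which is why \<open>height d m = a - 1\<close>.\<close>

lemma in_image_row_mark:
  assumes "y \<in> W n"
  shows "y \<in> row_mark ` rect_data n"
proof -
  obtain u a b where y: "y = (u, a, b)" by (cases y)
  from assms y have u: "sorted_wrt (\<ge>) u" "\<forall>x\<in>set u. 0 < x" "sum_list u = n" and a: "1 \<le> a"
    "a \<le> durfee u" and b: "1 \<le> b" "b \<le> part u 1"
    and W: "a = 1 \<Longrightarrow> smallest_part (conjugate u) < height u b"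
    by (auto simp: U_def W_def partition_of_def part_conjugate)
  define m where "m = part u a"
  define k where "k = a - 1"
  define h where "h = height u m"
  define w where "w = h - k"
  define d where "d = take k u @ drop h u"
  have am: "a \<le> m" using le_durfee_iff[OF u(1) a(1)] a(2) by (simp add: m_def)
  have m: "1 \<le> m" using am a by simp
  have kh: "k < h" using le_height_iff[OF u(1) a(1) m] a(1) by (simp add: m_def h_def k_def)
  have w: "0 < w" using kh by (simp add: w_def)
  have hl: "h \<le> length u" by (simp add: h_def height_le_length)
  have mid: "part u i = m" if "a \<le> i" "i \<le> h" for i
  proof (rule antisym)
    show "part u i \<le> m" unfolding m_def using part_antimono[OF u(1) a(1)] that by simp
    show "m \<le> part u i" using le_height_iff[OF u(1) _ m, of i] that a(1) by (simp add: h_def)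
  qed
  have pd: "part d i = (if i \<le> k then part u i else part u (i + w))" if "1 \<le> i" for i
    using that hl kh by (auto simp: d_def part_append part_take part_drop w_def add.commute)
  have sd: "sorted_wrt (\<ge>) d"
    using part_antimono[OF u(1)] unfolding sorted_wrt_ge_iff_part by (simp add: pd)
  have posd: "\<forall>x\<in>set d. 0 < x" using u(2) by (auto simp: d_def dest: in_set_takeD in_set_dropD)
  have uh: "part u (Suc h) < m" using le_height_iff[OF u(1) _ m, of "Suc h"] by (simp add: h_def)
  \<comment> \<open>Position \<open>a\<close> of \<open>d\<close> holds row \<open>h + 1\<close> of
    \<open>u\<close>, the first row shorter than \<open>m\<close>.\<close>
  have "\<not> a \<le> k" "a + w = Suc h" using a(1) kh by (auto simp: k_def w_def)
  then have da: "part d a < m" using uh pd[OF a(1)] by simp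
  have hd: "height d m = k"
  proof (rule height_eqI[OF sd m])
    show "m \<le> part d k" if "1 \<le> k"
      using pd[OF that] part_antimono[OF u(1) that, of a] by (simp add: m_def k_def)
    show "part d (Suc k) < m" using da a(1) by (simp add: k_def)
  qed
  have ueq: "u = insert_parts d m w"
  proof (rule part_eqI[OF u(2) pos_insert_parts[OF posd m]])
    fix i :: nat assume i: "1 \<le> i"
    show "part u i = part (insert_parts d m w) i"
      using mid[of i] i kh by (auto simp: part_insert_parts hd pd w_def k_def)
  qed
  \<comment> \<open>If \<open>a = 1\<close>, then \<open>w = h\<close> is the smallest part of the
    conjugate, and the condition in \<open>W n\<close> says that column \<open>b\<close> reaches row
    \<open>w + 1\<close>, which becomes the first row of \<open>d\<close>. Otherwise the first row
    is kept.\<close>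
  have b2: "b \<le> part d 1"
  proof (cases "a = 1")
    case True
    then have "w < height u b"
      using W smallest_part_conjugate[OF u(1)] m by (simp add: m_def h_def w_def k_def)
    then have "b \<le> part u (Suc w)" using le_height_iff[OF u(1) _ b(1), of "Suc w"] by simp
    then show ?thesis using True pd[of 1] by (simp add: k_def)
  next
    case False
    then have "1 \<le> k" using a(1) by (simp add: k_def)
    then show ?thesis using pd[of 1] b(2) by simp
  qed
  have "part d m < m" using part_antimono[OF sd a(1) am] da by simp
  then have "(d, m, w, b) \<in> rect_data n"
    using sd posd w b b2 u(3) sum_insert_parts[of d m w] ueq by (auto simp: rect_data_def)
  moreover have "y = row_mark (d, m, w, b)"
    using y ueq hd a(1) by (simp add: k_def)
  ultimately show ?thesis by blast
qed

text \<open>The data can be read off in turn: \<open>k\<close> from the row mark, \<open>m\<close>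
  as row \<open>k + 1\<close>, \<open>w\<close> from the \<open>k + w\<close> parts that are at
  least \<open>m\<close>, and \<open>d\<close> from the remaining rows.\<close>

lemma inj_on_row_mark: "inj_on row_mark (rect_data n)"
proof (rule inj_onI)
  fix x x' assume X: "x \<in> rect_data n" "x' \<in> rect_data n" and eq: "row_mark x = row_mark x'"
  obtain d m w b where x: "x = (d, m, w, b)" by (cases x)
  obtain d' m' w' b' where x': "x' = (d', m', w', b')" by (cases x')
  have d: "sorted_wrt (\<ge>) d" "\<forall>x\<in>set d. 0 < x" "0 < w" "1 \<le> m"
    and d': "sorted_wrt (\<ge>) d'" "\<forall>x\<in>set d'. 0 < x" "0 < w'" "1 \<le> m'"
    using X x x' by (auto simp: rect_data_def)
  have b: "b = b'" and k: "height d m = height d' m'"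
    and u: "insert_parts d m w = insert_parts d' m' w'" using eq x x' by auto
  define k where "k = height d m"
  have m: "m = m'"
    using arg_cong[OF u, of "\<lambda>u. part u (Suc k)"] d(3) d'(3)
    by (simp add: part_insert_parts k_def flip: k)
  have *: "height (insert_parts d m w) m = k + w" if "sorted_wrt (\<ge>) d" "0 < w" "height d m = k"
    for d w
    using that d(4) le_height_iff[OF that(1), of "Suc k" m]
    by (intro height_eqI sorted_insert_parts) (auto simp: part_insert_parts)
  have w: "w = w'" using *[OF d(1,3)] *[OF d'(1,3)] u m k k_def by simp
  have "d = d'"
  proof (rule part_eqI[OF d(2) d'(2)])
    fix i :: nat assume "1 \<le> i"
    then show "part d i = part d' i"
      \<comment> \<open>The shifted index jumps over the \<open>w\<close> inserted rows.\<close>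
      using arg_cong[OF u, of "\<lambda>u. part u (if i \<le> k then i else i + w)"] k w
      by (auto simp: part_insert_parts k_def split: if_splits)
  qed
  then show "x = x'" using x x' b m w by simp
qed

section \<open>The action of tau on rectangle data\<close>

lemma tau_column_mark:
  assumes "x \<in> rect_data n"
  shows "tau (column_mark x) = row_mark x"
proof -
  obtain d m w b where x: "x = (d, m, w, b)" by (cases x)
  let ?l = "add_columns d m w" and ?s = "Suc (part d m)" and ?k = "height d m"
  from assms x have d: "sorted_wrt (\<ge>) d" "\<forall>x\<in>set d. 0 < x" "0 < w" "part d m < m"
    by (auto simp: rect_data_def)
  then have m: "1 \<le> m" by simp
  note so = sorted_add_columns[OF d(1), of m w]
  have h: "height ?l ?s = m" by (rule height_add_columns[OF d(1) m d(3)])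
  have c: "part (conjugate ?l) ?s = m" using part_conjugate[OF so] h by simp
  \<comment> \<open>The added columns end at \<open>p\<close>, so \<open>p - s + 1 = w\<close> and
    the subtraction in \<open>tau_delta\<close> undoes the addition exactly.\<close>
  have p: "tau_p ?l ?s = part d m + w"
    using tau_p_eq[OF so _ h[symmetric]] m by (simp add: part_add_columns)
  have tm: "take m ?l = map (\<lambda>x. x + w) (take m d @ replicate (m - length d) 0)"
    and dm: "drop m ?l = drop m d" by (auto simp: add_columns_def)
  \<comment> \<open>All parts of \<open>d\<close> are positive, so the filter in
    \<open>tau_delta\<close> removes only the padding zeros.\<close>
  have fd: "filter (\<lambda>x. 0 < x) (take m d) = take m d" "filter (\<lambda>x. 0 < x) (drop m d) = drop m d"
    using d(2) by (auto simp: filter_id_conv dest: in_set_takeD in_set_dropD)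
  have delta: "tau_delta ?l ?s = d"
    unfolding tau_delta_def Let_def c p tm dm
    by (simp add: o_def fd)
  have a: "tau_a ?l ?s = Suc ?k"
    unfolding tau_a_def delta c
  proof (rule Least_equality)
    show "1 \<le> Suc ?k \<and> part d (Suc ?k) < m"
      using le_height_iff[OF d(1), of "Suc ?k" m] m by simp
    show "Suc ?k \<le> y" if "1 \<le> y \<and> part d y < m" for y
      using le_height_iff[OF d(1), of y m] m that by simp
  qed
  have "map (part (conjugate ?l)) [?s..<part d m + w + 1] = replicate w m"
  proof (rule nth_equalityI)
    fix i assume "i < length (map (part (conjugate ?l)) [?s..<part d m + w + 1])"
    then have i: "i < w" by (simp del: upt_Suc)
    \<comment> \<open>For \<open>i < w\<close> this is one of the added columns: row
      \<open>m\<close> reaches it and row \<open>m + 1\<close> does not.\<close>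
    have "height ?l (?s + i) = m"
      using part_antimono[OF d(1) m, of "Suc m"] m i
      by (intro height_eqI so) (auto simp: part_add_columns)
    then show "map (part (conjugate ?l)) [?s..<part d m + w + 1] ! i = replicate w m ! i"
      using i part_conjugate[OF so, of "?s + i"] by (simp del: upt_Suc)
  qed simp
  then have mu: "tau_mu ?l ?s = insert_parts d m w"
    unfolding tau_mu_def Let_def delta a p by (simp add: insert_parts_def del: upt_Suc)
  have "tau_b ?l ?s (if b \<le> part d m then b else b + w) = b"
    using p by (auto simp: tau_b_def)
  then show ?thesis using x a mu by simp
qed

theorem theorem3p3:
  fixes n :: nat
  assumes "0 < n"
  shows "bij_betw tau (U n - Q n) (W n)"
proof -
  have U: "U n - Q n = column_mark ` rect_data n"
    by (rule subset_antisym[OF subsetI[OF in_image_column_mark] image_subsetI[OF column_mark_in]])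
  have W: "W n = row_mark ` rect_data n"
    by (rule subset_antisym[OF subsetI[OF in_image_row_mark] image_subsetI[OF row_mark_in]])
  \<comment> \<open>The composite agrees with \<open>row_mark\<close> on \<open>rect_data n\<close>,
    and its injectivity there gives that of \<open>tau\<close> on the image of
    \<open>column_mark\<close>.\<close>
  have "inj_on (tau \<circ> column_mark) (rect_data n)"
    using inj_on_row_mark[of n] by (simp add: tau_column_mark cong: inj_on_cong)
  moreover have "tau ` column_mark ` rect_data n = row_mark ` rect_data n"
    by (simp add: image_image tau_column_mark cong: image_cong)
  ultimately show ?thesis
    unfolding U W bij_betw_def using inj_on_imageI by blast
qed

end
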